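(* Let $N\in\mathbb N$, let $G^N\in[0,1]^{N\times N}$ be symmetric with $G^N_{ii}=0$ for all $i$, $\beta\in\mathbb R$, $C_B>0$, $P:\mathcal A\times\mathcal A\to\mathbb R$, and $\theta^N\in\mathcal A^N$. Consider the utility functional $U(\tilde a,\tilde z,\tilde\theta)=\langle\tilde a,\tilde\theta+\beta\tilde z\rangle_{\mathcal A}-\frac12\|\tilde a\|_{\mathcal A}^2+P(\tilde z,\tilde\theta)$ and the network intervention problem $$\max_{\hat\theta^N\in\mathcal A^N}T^N(\hat\theta^N)=\frac1N\sum_{i=1}^NU(\bar a^{i,N},\bar z^{i,N},\theta^{i,N}+\hat\theta^{i,N})\quad\text{s.t. }\bar a^N=(I^N-\tfrac\beta NG^N)^{-1}(\theta^N+\hat\theta^N),\ \bar z^N=\tfrac1NG^N\bar a^N\ (\mathbb P\otimes dt\text{-a.e.}),\ \tfrac1N\|\hat\theta^N\|_{\mathcal A^N}^2\le C_B.$$ Assume: (B1) $\beta\lambda_1(G^N)<N$. (B2) There exists $\tilde w\in\mathbb R$ such that for every $\vartheta^N\in\mathcal A^N$, with $\bar a^N=(I^N-\frac\beta NG^N)^{-1}\vartheta^N$, one has $\frac1N\sum_{i=1}^NP\big(z^{i,N}(\bar a^N),\vartheta^{i,N}\big)=\tilde w\|\bar a^N\|_{\mathcal A^N}^2$; and either $\tilde w<-\frac1{2N}$ and $\frac1N\|\theta^N\|_{\mathcal A^N}^2>C_B$, or $\tilde w>-\frac1{2N}$. Moreover $\underline\theta^N_k\ne0$, $\mathbb P\otimes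 dt$-a.e., for each $k$. Set $w:=\tilde w+\frac1{2N}$ and $\alpha^N_k:=(1-\beta\lambda_k^N/N)^{-2}$. Then the cosine similarity between the optimal intervention $\bar\theta^N$ (the solution of the network intervention problem) and the $k$-th principal component of $G^N$ is given by $$\rho\big(\bar\theta^N,U^N_{\bullet k}\big)=\frac{\|\theta^N\|_{\mathbb R^N}}{\|\bar\theta^N\|_{\mathbb R^N}}\,\rho\big(\theta^N,U^N_{\bullet k}\big)\,\frac{w\alpha^N_k}{\mu-w\alpha^N_k},\quad\mathbb P\otimes dt\text{-a.e.},\ k=1,\dots,N,$$ where $\mu$ is uniquely determined as the solution to $$C_B=\frac1N\sum_{k=1}^N\Big(\frac{w\alpha^N_k}{\mu-w\alpha^N_k}\Big)^2\|\underline\theta^N_k\|_{\mathcal A}^2$$ satisfying $\mu>w\alpha^N_k$ for all $k$. In particular, the optimal intervention in the $k$-th principal component is explicitly given by $$\underline{\bar\theta}^N_k=\frac{w\alpha^N_k}{\mu-w\alpha^N_k}\,\underline\theta^N_k,\quad\mathbb P\otimes dt\text{-a.e.},\ k=1,\dots,N.$$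
   Context: Fix $T>0$ and a filtered probability space $(\Omega,\mathcal F,\mathbb F=(\mathcal F_t)_{0\le t\le T},\mathbb P)$ satisfying the usual conditions. $\mathcal A$ is the Hilbert space of $\mathbb F$-progressively measurable $\tilde a:\Omega\times[0,T]\to\mathbb R$ with $\|\tilde a\|_{\mathcal A}^2=\int_0^T\mathbb E[\tilde a_t^2]dt<\infty$ and $\langle\tilde a,\tilde b\rangle_{\mathcal A}=\mathbb E[\int_0^T\tilde a_t\tilde b_tdt]$; $\mathcal A^N$ carries $\|a^N\|_{\mathcal A^N}^2=\sum_i\|a^{i,N}\|_{\mathcal A}^2$. $I^N$ is the identity matrix; $z^{i,N}(a^N)=\frac1N\sum_jG^N_{ij}a^{j,N}$. (For heterogeneity vector $\vartheta^N$, the vector $(I^N-\frac\beta NG^N)^{-1}\vartheta^N$ is the Nash equilibrium of the network game with utility $U$ and action sets $\mathcal A$.) Spectral decomposition: $G^N=U^N\Lambda^N(U^N)^\top$ with $\Lambda^N$ diagonal, entries $\lambda_1^N\ge\dots\ge\lambda_N^N$ the eigenvalues of $G^N$ ($\lambda_1(G^N)=\lambda_1^N$ is the largest eigenvalue), and $U^N$ orthogonal, with $k$-th column $U^N_{\bullet k}$ a normalized eigenvector for $\lambda_k^N$ (the $k$-th principal component). For $d\in\mathbb R^N$, $\underline d=(U^N)^\top d$, with $k$-th component $\underline d_k$; for $\mathbb R^N$-valued processes this is applied pointwise in $(t,\omega)$. Cosine similarity of nonzero $c,d\in\mathbb R^N$: $\rho(c,d)=\langle c,d\rangle_{\mathbb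 R^N}/(\|c\|_{\mathbb R^N}\|d\|_{\mathbb R^N})$, applied pointwise in $(t,\omega)$.
   Formalization: The matrix I − (β/N)G is additionally assumed invertible: for β<0, (B1) does not imply this (N=2, G with off-diagonal entries 1, β=−2), and then the equilibrium and α_k in the statement are undefined. *)

theory Defs
  imports "HOL-Probability.Probability"
begin

section \<open>Filtered probability spaces on a finite horizon\<close>

text \<open>
  Only the sigma-algebras of the measures \<open>F t\<close> matter, and only for \<open>t\<close> in \<open>{0..T}\<close>.
\<close>

locale usual_filtered_prob_space = prob_space M + complete_measure M
  for M :: "'w measure" and F :: "real \<Rightarrow> 'w measure" and T :: real +
  assumes horizon_pos: "0 < T"
    and filtration_sub: "\<And>t. t \<in> {0..T} \<Longrightarrow> subalgebra M (F t)"
    and filtration_mono: "\<And>s t. 0 \<le> s \<Longrightarrow> s \<le> t \<Longrightarrow> t \<le> T \<Longrightarrow> sets (F s) \<subseteq> sets (F t)"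
    and filtration_null: "null_sets M \<subseteq> sets (F 0)"
    and filtration_right_cont:
      "\<And>t. t \<in> {0..<T} \<Longrightarrow> sets (F t) = (\<Inter>s\<in>{t<..T}. sets (F s))"

abbreviation time_measure :: "real \<Rightarrow> real measure" where
  "time_measure T \<equiv> restrict_space lborel {0..T}"

abbreviation prod_time :: "'w measure \<Rightarrow> real \<Rightarrow> ('w \<times> real) measure" where
  "prod_time M T \<equiv> M \<Otimes>\<^sub>M time_measure T"


section \<open>The space of square-integrable progressively measurable processes\<close>

text \<open>
  Processes are functions of the pair \<open>(\<omega>, t)\<close>; their values outside
  \<open>space M \<times> {0..T}\<close> are irrelevant. The Hilbert space is represented by its
  representatives, without passing to classes modulo almost everywhere equality.
\<close>

definition progressively_measurable ::
    "(real \<Rightarrow> 'w measure) \<Rightarrow> real \<Rightarrow> ('w \<times> real \<Rightarrow> real) \<Rightarrow> bool" where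
  "progressively_measurable F T a \<longleftrightarrow>
     (\<forall>t\<in>{0..T}. a \<in> borel_measurable (F t \<Otimes>\<^sub>M restrict_space borel {0..t}))"

definition energy :: "'w measure \<Rightarrow> real \<Rightarrow> ('w \<times> real \<Rightarrow> real) \<Rightarrow> ennreal" where
  "energy M T a = (\<integral>\<^sup>+t. (\<integral>\<^sup>+\<omega>. ennreal ((a (\<omega>, t))\<^sup>2) \<partial>M) \<partial>time_measure T)"

definition procs :: "'w measure \<Rightarrow> (real \<Rightarrow> 'w measure) \<Rightarrow> real \<Rightarrow> ('w \<times> real \<Rightarrow> real) set" where
  "procs M F T = {a. progressively_measurable F T a \<and> energy M T a < \<infinity>}"

definition proc_norm :: "'w measure \<Rightarrow> real \<Rightarrow> ('w \<times> real \<Rightarrow> real) \<Rightarrow> real" where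
  "proc_norm M T a = sqrt (enn2real (energy M T a))"

definition proc_inner ::
    "'w measure \<Rightarrow> real \<Rightarrow> ('w \<times> real \<Rightarrow> real) \<Rightarrow> ('w \<times> real \<Rightarrow> real) \<Rightarrow> real" where
  "proc_inner M T a b = (\<integral>\<omega>. (\<integral>t. a (\<omega>, t) * b (\<omega>, t) \<partial>time_measure T) \<partial>M)"

text \<open>
  An \<open>N\<close>-tuple of processes is a single vector-valued process; \<open>N\<close> is \<open>CARD('n)\<close>.
\<close>

definition component :: "('w \<times> real \<Rightarrow> real ^ 'n) \<Rightarrow> 'n \<Rightarrow> 'w \<times> real \<Rightarrow> real" where
  "component a i = (\<lambda>x. a x $ i)"

definition procsN ::
    "'w measure \<Rightarrow> (real \<Rightarrow> 'w measure) \<Rightarrow> real \<Rightarrow> ('w \<times> real \<Rightarrow> real ^ 'n) set" where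
  "procsN M F T = {a. \<forall>i. component a i \<in> procs M F T}"

definition procN_norm :: "'w measure \<Rightarrow> real \<Rightarrow> ('w \<times> real \<Rightarrow> real ^ 'n) \<Rightarrow> real" where
  "procN_norm M T a = sqrt (\<Sum>i\<in>UNIV. (proc_norm M T (component a i))\<^sup>2)"


section \<open>Matrices\<close>

definition largest_eigenvalue :: "real ^ 'n ^ 'n \<Rightarrow> real" where
  "largest_eigenvalue A = Max {c. \<exists>v. v \<noteq> 0 \<and> A *v v = c *\<^sub>R v}"

text \<open>
  The linear order of the index type provides the enumeration \<open>1, \<dots>, N\<close>, with respect to
  which the eigenvalues decrease.
\<close>

definition spectral_decomposition ::
    "real ^ 'n::{finite,linorder} ^ 'n::{finite,linorder}
     \<Rightarrow> real ^ 'n::{finite,linorder} ^ 'n::{finite,linorder} \<Rightarrow> ('n::{finite,linorder} \<Rightarrow> real) \<Rightarrow> bool" where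
  "spectral_decomposition A Q l \<longleftrightarrow>
     orthogonal_matrix Q \<and> antimono l \<and>
     A = Q ** (\<chi> i j. if i = j then l i else 0) ** transpose Q"

definition cosine_similarity :: "real ^ 'n \<Rightarrow> real ^ 'n \<Rightarrow> real" where
  "cosine_similarity c d = (c \<bullet> d) / (norm c * norm d)"


section \<open>The network game and the intervention problem\<close>

definition aggregate :: "real ^ 'n ^ 'n \<Rightarrow> ('w \<times> real \<Rightarrow> real ^ 'n) \<Rightarrow> 'w \<times> real \<Rightarrow> real ^ 'n" where
  "aggregate G a = (\<lambda>x. (1 / real CARD('n)) *\<^sub>R (G *v a x))"

text \<open>Meaningful only if the matrix being inverted is invertible.\<close>

definition nash ::
    "real \<Rightarrow> real ^ 'n ^ 'n \<Rightarrow> ('w \<times> real \<Rightarrow> real ^ 'n) \<Rightarrow> 'w \<times> real \<Rightarrow> real ^ 'n" where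
  "nash \<beta> G \<xi> = (\<lambda>x. matrix_inv (mat 1 - (\<beta> / real CARD('n)) *\<^sub>R G) *v \<xi> x)"

text \<open>
  The functional \<open>P\<close> acts on representatives and need not respect almost everywhere equality;
  functionals on the Hilbert space itself are the special case where it does.
\<close>

definition utility ::
    "'w measure \<Rightarrow> real \<Rightarrow> real
     \<Rightarrow> (('w \<times> real \<Rightarrow> real) \<Rightarrow> ('w \<times> real \<Rightarrow> real) \<Rightarrow> real)
     \<Rightarrow> ('w \<times> real \<Rightarrow> real) \<Rightarrow> ('w \<times> real \<Rightarrow> real) \<Rightarrow> ('w \<times> real \<Rightarrow> real) \<Rightarrow> real" where
  "utility M T \<beta> P a z \<theta> =
     proc_inner M T a (\<lambda>x. \<theta> x + \<beta> * z x) - 1 / 2 * (proc_norm M T a)\<^sup>2 + P z \<theta>"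

text \<open>
  The equilibrium constraints determine actions and aggregates up to null sets from the
  intervention \<open>\<eta>\<close>; the pointwise representatives are used.
\<close>

definition intervention_objective ::
    "'w measure \<Rightarrow> real \<Rightarrow> real
     \<Rightarrow> (('w \<times> real \<Rightarrow> real) \<Rightarrow> ('w \<times> real \<Rightarrow> real) \<Rightarrow> real)
     \<Rightarrow> real ^ 'n ^ 'n \<Rightarrow> ('w \<times> real \<Rightarrow> real ^ 'n) \<Rightarrow> ('w \<times> real \<Rightarrow> real ^ 'n) \<Rightarrow> real" where
  "intervention_objective M T \<beta> P G \<theta> \<eta> =
     (let a = nash \<beta> G (\<lambda>x. \<theta> x + \<eta> x); z = aggregate G a
      in 1 / real CARD('n) *
         (\<Sum>i\<in>UNIV. utility M T \<beta> P (component a i) (component z i)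
            (\<lambda>x. component \<theta> i x + component \<eta> i x)))"

definition feasible_intervention ::
    "'w measure \<Rightarrow> (real \<Rightarrow> 'w measure) \<Rightarrow> real \<Rightarrow> real \<Rightarrow> ('w \<times> real \<Rightarrow> real ^ 'n) \<Rightarrow> bool" where
  "feasible_intervention M F T C \<eta> \<longleftrightarrow>
     \<eta> \<in> procsN M F T \<and> 1 / real CARD('n) * (procN_norm M T \<eta>)\<^sup>2 \<le> C"

definition optimal_intervention ::
    "'w measure \<Rightarrow> (real \<Rightarrow> 'w measure) \<Rightarrow> real \<Rightarrow> real \<Rightarrow> real
     \<Rightarrow> (('w \<times> real \<Rightarrow> real) \<Rightarrow> ('w \<times> real \<Rightarrow> real) \<Rightarrow> real)
     \<Rightarrow> real ^ 'n ^ 'n \<Rightarrow> ('w \<times> real \<Rightarrow> real ^ 'n) \<Rightarrow> ('w \<times> real \<Rightarrow> real ^ 'n) \<Rightarrow> bool" where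
  "optimal_intervention M F T C \<beta> P G \<theta> =
     is_arg_max (intervention_objective M T \<beta> P G \<theta>) (feasible_intervention M F T C)"

text \<open>Coordinates with respect to the columns of \<open>Q\<close>, that is, the principal components.\<close>

definition principal :: "real ^ 'n ^ 'n \<Rightarrow> ('w \<times> real \<Rightarrow> real ^ 'n) \<Rightarrow> 'w \<times> real \<Rightarrow> real ^ 'n" where
  "principal Q d = (\<lambda>x. transpose Q *v d x)"

definition budget_multiplier ::
    "'w measure \<Rightarrow> real \<Rightarrow> real \<Rightarrow> real ^ 'n ^ 'n \<Rightarrow> ('w \<times> real \<Rightarrow> real ^ 'n)
     \<Rightarrow> real \<Rightarrow> ('n \<Rightarrow> real) \<Rightarrow> real \<Rightarrow> bool" where
  "budget_multiplier M T C Q \<theta> w \<alpha> \<mu> \<longleftrightarrow>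
     (\<forall>k. \<mu> > w * \<alpha> k) \<and>
     C = 1 / real CARD('n) *
         (\<Sum>k\<in>UNIV. (w * \<alpha> k / (\<mu> - w * \<alpha> k))\<^sup>2 *
            (proc_norm M T (component (principal Q \<theta>) k))\<^sup>2)"

end

theory Submission
  imports Defs
begin

text \<open>
  In equilibrium \<open>\<xi> + \<beta> z = a\<close>, so the objective is \<open>w \<parallel>a\<parallel>\<^sup>2\<close>, which in principal coordinates is
  the diagonal quadratic form \<open>\<Sum>k. w \<alpha>\<^sub>k \<parallel>\<theta>\<^sub>k + \<eta>\<^sub>k\<parallel>\<^sup>2\<close>. The Lagrangian with multiplier \<open>\<mu>\<close> is a
  constant minus \<open>\<Sum>k. (\<mu> - w \<alpha>\<^sub>k) \<parallel>\<eta>\<^sub>k - w \<alpha>\<^sub>k / (\<mu> - w \<alpha>\<^sub>k) \<theta>\<^sub>k\<parallel>\<^sup>2\<close>. Since \<open>\<mu> > 0\<close>, the intervention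
  annihilating this sum, which spends the whole budget, is optimal, and every optimal intervention
  annihilates it. The multiplier itself comes from the intermediate value theorem.
\<close>

section \<open>The budget equation\<close>

text \<open>To the right of all poles \<open>c k\<close> every denominator is positive and grows
  with the argument, so each summand falls strictly. This is the source of uniqueness of the
  multiplier.\<close>

lemma inverse_square_sum_strict_decreasing:
  fixes c s :: "'k::finite \<Rightarrow> real"
  assumes "\<forall>k. x > c k" "\<forall>k. c k \<noteq> 0" "\<forall>k. s k > 0" "x < y"
  shows "(\<Sum>k\<in>UNIV. (c k / (y - c k))\<^sup>2 * s k) < (\<Sum>k\<in>UNIV. (c k / (x - c k))\<^sup>2 * s k)"
proof (rule sum_strict_mono)
  fix k
  have x: "0 < x - c k" and "x - c k < y - c k" using assms by auto
  then have "(x - c k)\<^sup>2 < (y - c k)\<^sup>2" by (intro power_strict_mono) auto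
  moreover have "0 < (c k)\<^sup>2" "0 < (x - c k)\<^sup>2" using assms x by auto
  ultimately have "(c k)\<^sup>2 / (y - c k)\<^sup>2 < (c k)\<^sup>2 / (x - c k)\<^sup>2"
    by (intro divide_strict_left_mono mult_pos_pos) auto
  then show "(c k / (y - c k))\<^sup>2 * s k < (c k / (x - c k))\<^sup>2 * s k"
    unfolding power_divide using assms by (intro mult_strict_right_mono) auto
qed auto

lemma inverse_square_sum_tendsto_0:
  fixes c s :: "'k::finite \<Rightarrow> real"
  shows "((\<lambda>x. \<Sum>k\<in>UNIV. (c k / (x - c k))\<^sup>2 * s k) \<longlongrightarrow> 0) at_top"
proof -
  have "((\<lambda>x. (c k / (x - c k))\<^sup>2 * s k) \<longlongrightarrow> 0\<^sup>2 * s k) at_top" for k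
    by (intro tendsto_intros real_tendsto_divide_at_top filterlim_tendsto_add_at_top
      [where f = "\<lambda>_. - c k" and g = "\<lambda>x. x", simplified add.commute[of "- c k"] add_uminus_conv_diff])
      (auto simp: filterlim_ident)
  then show ?thesis by (intro tendsto_null_sum) simp
qed

text \<open>The sum is above \<open>C\<close> at \<open>x\<close> and, by its limit 0 at infinity,
  below \<open>C\<close> at some later \<open>z\<close>. No pole lies in \<open>{x..z}\<close>, so
  the intermediate value theorem applies there.\<close>

lemma inverse_square_sum_root:
  fixes c s :: "'k::finite \<Rightarrow> real"
  assumes x: "\<forall>k. x > c k" and large: "(\<Sum>k\<in>UNIV. (c k / (x - c k))\<^sup>2 * s k) > C" and "C > 0"
  shows "\<exists>y. (\<forall>k. y > c k) \<and> (\<Sum>k\<in>UNIV. (c k / (y - c k))\<^sup>2 * s k) = C"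
proof -
  define f where "f y = (\<Sum>k\<in>UNIV. (c k / (y - c k))\<^sup>2 * s k)" for y
  have "\<forall>\<^sub>F y in at_top. f y < C"
    using inverse_square_sum_tendsto_0[of c s] \<open>C > 0\<close> unfolding f_def by (rule order_tendstoD(2))
  then have "\<forall>\<^sub>F y in at_top. f y < C \<and> x \<le> y" using eventually_ge_at_top by (rule eventually_conj)
  then obtain z where "f z < C" "x \<le> z"
    using eventually_happens'[of at_top] trivial_limit_at_top_linorder by blast
  moreover have "y - c k \<noteq> 0" if "x \<le> y" for y k using x that by (metis less_le_not_le right_minus_eq)
  then have "continuous_on {x..z} f"
    unfolding f_def by (intro continuous_intros) auto
  ultimately obtain y where "x \<le> y" "f y = C"
    using IVT2'[of f z C x] large unfolding f_def by auto
  then show ?thesis using x unfolding f_def by (metis less_le_trans)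
qed

text \<open>The summand belonging to the largest pole blows up by itself as that pole is approached
  from the right, and the others are nonnegative.\<close>

lemma inverse_square_sum_unbounded:
  fixes c s :: "'k::finite \<Rightarrow> real"
  assumes "\<forall>k. c k > 0" "\<forall>k. s k > 0"
  shows "\<exists>x. (\<forall>k. x > c k) \<and> (\<Sum>k\<in>UNIV. (c k / (x - c k))\<^sup>2 * s k) > C"
proof -
  have "Max (range c) \<in> range c" by (intro Max_in) auto
  then obtain m where m: "c m = Max (range c)" by (metis rangeE)
  have max: "c k \<le> c m" for k unfolding m by (rule Max_ge) auto
  \<comment> \<open>\<open>d\<close> solves
    \<open>(c m / d)\<^sup>2 * s m = \<bar>C\<bar> + 1\<close>, so at \<open>c m + d\<close> the
    summand \<open>m\<close> alone exceeds \<open>C\<close>.\<close>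
  define d where "d = c m * sqrt (s m / (\<bar>C\<bar> + 1))"
  have d: "d > 0" unfolding d_def using assms by (auto intro!: mult_pos_pos)
  have "\<bar>C\<bar> + 1 = (c m / d)\<^sup>2 * s m"
    unfolding d_def using assms by (simp add: power_divide power_mult_distrib less_imp_le less_imp_neq[THEN not_sym])
  also have "\<dots> = (\<Sum>k\<in>{m}. (c k / (c m + d - c k))\<^sup>2 * s k)" by simp
  also have "\<dots> \<le> (\<Sum>k\<in>UNIV. (c k / (c m + d - c k))\<^sup>2 * s k)"
    using assms by (intro sum_mono2) (auto simp: less_imp_le)
  finally have "(\<Sum>k\<in>UNIV. (c k / (c m + d - c k))\<^sup>2 * s k) > C" by linarith
  moreover have "c m + d > c k" for k using max[of k] d by linarith
  ultimately show ?thesis by blast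
qed

section \<open>Spectral decompositions\<close>

text \<open>Coordinates in the eigenbasis are kept in the form \<open>transpose Q *v v\<close>, not
  as row-vector products.\<close>

declare transpose_matrix_vector [simp del]

lemma orthogonal_matrix_cancel:
  fixes Q :: "real ^ 'n ^ 'n"
  assumes "orthogonal_matrix Q"
  shows "transpose Q *v (Q *v v) = v" "Q *v (transpose Q *v v) = v"
  using assms by (simp_all add: orthogonal_matrix_def matrix_vector_mul_assoc)

lemma norm_transpose_orthogonal_matrix:
  fixes Q :: "real ^ 'n ^ 'n"
  assumes "orthogonal_matrix Q"
  shows "norm (transpose Q *v v) = norm v"
  using assms orthogonal_transformation_matrix[of "(*v) (transpose Q)"]
  by (simp add: orthogonal_transformation_norm)

text \<open>\<open>transpose Q\<close> cancels the leading \<open>Q\<close> of the decomposition,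
  which leaves a diagonal matrix acting on the coordinates of \<open>v\<close>. This decouples the
  equilibrium equation.\<close>

lemma spectral_decomposition_coordinate:
  fixes A Q :: "real ^ 'n::{finite,linorder} ^ 'n::{finite,linorder}"
  assumes "spectral_decomposition A Q l"
  shows "(transpose Q *v ((mat 1 - c *\<^sub>R A) *v v)) $ k = (1 - c * l k) * (transpose Q *v v) $ k"
proof -
  define D :: "real ^ 'n::{finite,linorder} ^ 'n::{finite,linorder}" where "D = (\<chi> i j. if i = j then l i else 0)"
  have Q: "orthogonal_matrix Q" and A: "A = Q ** D ** transpose Q"
    using assms by (auto simp: spectral_decomposition_def D_def)
  have "transpose Q *v (A *v v) = D *v (transpose Q *v v)"
    by (simp add: A orthogonal_matrix_cancel[OF Q] flip: matrix_vector_mul_assoc)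
  moreover have "(D *v u) $ k = l k * u $ k" for u
    by (simp add: D_def matrix_vector_mult_def if_distrib[where f = "\<lambda>x. x * _"] sum.delta cong: if_cong)
  ultimately have "(transpose Q *v (A *v v)) $ k = l k * (transpose Q *v v) $ k" by simp
  then show ?thesis
    by (simp add: matrix_vector_mult_diff_rdistrib matrix_vector_mult_diff_distrib
        scaleR_matrix_vector_assoc[symmetric] matrix_vector_mult_scaleR algebra_simps)
qed

text \<open>If the factor vanished, the eigenvector \<open>Q *v axis k 1\<close> would be a nonzero
  element of the kernel: its only nonzero coordinate is the \<open>k\<close>-th, and that one is
  killed.\<close>

lemma spectral_decomposition_invertible:
  fixes A Q :: "real ^ 'n::{finite,linorder} ^ 'n::{finite,linorder}"
  assumes A: "spectral_decomposition A Q l" and inv: "invertible (mat 1 - c *\<^sub>R A)"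
  shows "1 - c * l k \<noteq> 0"
proof
  assume 0: "1 - c * l k = 0"
  have Q: "orthogonal_matrix Q" using A by (simp add: spectral_decomposition_def)
  define v where "v = Q *v axis k 1"
  have "(transpose Q *v ((mat 1 - c *\<^sub>R A) *v v)) $ j = 0" for j
    unfolding spectral_decomposition_coordinate[OF A] v_def orthogonal_matrix_cancel[OF Q]
    using 0 by (simp add: axis_def)
  then have "transpose Q *v ((mat 1 - c *\<^sub>R A) *v v) = 0" by (simp add: vec_eq_iff)
  then have "(mat 1 - c *\<^sub>R A) *v v = 0"
    by (metis orthogonal_matrix_cancel(2)[OF Q] matrix_vector_mult_0_right)
  then have "v = 0"
    using inv by (metis invertible_def matrix_vector_mul_assoc matrix_vector_mul_lid matrix_vector_mult_0_right)
  then have "axis k (1::real) = 0"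
    unfolding v_def by (metis orthogonal_matrix_cancel(1)[OF Q] matrix_vector_mult_0_right)
  then show False by (simp add: axis_eq_0_iff)
qed

lemma matrix_inv_cancel:
  fixes A :: "real ^ 'n ^ 'n"
  assumes "invertible A"
  shows "A *v (matrix_inv A *v v) = v"
proof -
  have "A ** matrix_inv A = mat 1"
    using assms unfolding invertible_def matrix_inv_def by (rule someI2_ex) simp
  then show ?thesis by (simp add: matrix_vector_mul_assoc)
qed

text \<open>Links the numerator of the cosine similarity with a principal component to the
  corresponding principal coordinate.\<close>

lemma inner_column: "v \<bullet> column k Q = (transpose Q *v v) $ k"
  for Q :: "real ^ 'n ^ 'n"
  by (simp add: inner_vec_def column_def transpose_def matrix_vector_mult_def mult.commute)

section \<open>Square-integrable processes\<close>

context usual_filtered_prob_space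
begin

lemma finite_time_measure: "finite_measure (time_measure T)"
  by (intro finite_measureI) (simp add: space_restrict_space emeasure_restrict_space emeasure_lborel_Icc_eq)

sublocale time: finite_measure "time_measure T"
  by (rule finite_time_measure)

sublocale prod: pair_sigma_finite M "time_measure T" ..

text \<open>Progressive measurability at the final time \<open>T\<close> already gives joint
  measurability, because \<open>F T\<close> is contained in \<open>M\<close>.\<close>

lemma progressively_measurable_imp_measurable:
  assumes "progressively_measurable F T a"
  shows "a \<in> borel_measurable (prod_time M T)"
proof -
  have T: "T \<in> {0..T}" using horizon_pos by simp
  have sub: "space (F T) = space M" "sets (F T) \<subseteq> sets M"
    using filtration_sub[OF T] by (auto simp: subalgebra_def)
  have "a \<in> borel_measurable (F T \<Otimes>\<^sub>M restrict_space borel {0..T})"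
    using assms T unfolding progressively_measurable_def by blast
  moreover have "sets (F T \<Otimes>\<^sub>M restrict_space borel {0..T}) \<subseteq> sets (prod_time M T)"
    by (rule sets_pair_in_sets) (use sub in \<open>auto simp: sets_restrict_space\<close>)
  then have "subalgebra (prod_time M T) (F T \<Otimes>\<^sub>M restrict_space borel {0..T})"
    using sub by (simp add: subalgebra_def space_pair_measure space_restrict_space)
  ultimately show ?thesis by (rule measurable_from_subalg[rotated])
qed

text \<open>Tonelli. The energy integrates over states first and the inner product over time first;
  both are moved to the product measure, where the almost everywhere statements live.\<close>

lemma energy_eq_nn_integral:
  assumes "a \<in> borel_measurable (prod_time M T)"
  shows "energy M T a = (\<integral>\<^sup>+x. ennreal ((a x)\<^sup>2) \<partial>prod_time M T)"
  unfolding energy_def using assms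
  by (subst prod.nn_integral_snd[symmetric]) simp_all

lemma procs_iff:
  "a \<in> procs M F T \<longleftrightarrow>
    progressively_measurable F T a \<and> integrable (prod_time M T) (\<lambda>x. (a x)\<^sup>2)"
  using progressively_measurable_imp_measurable[of a] energy_eq_nn_integral[of a]
  by (auto simp: procs_def integrable_iff_bounded)

lemma procs_measurable: "a \<in> procs M F T \<Longrightarrow> a \<in> borel_measurable (prod_time M T)"
  using procs_iff progressively_measurable_imp_measurable by blast

lemma integrable_procs_mult:
  assumes "a \<in> procs M F T" "b \<in> procs M F T"
  shows "integrable (prod_time M T) (\<lambda>x. a x * b x)"
proof (rule Bochner_Integration.integrable_bound)
  show "integrable (prod_time M T) (\<lambda>x. (a x)\<^sup>2 + (b x)\<^sup>2)"
    using assms by (simp add: procs_iff)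
  show "(\<lambda>x. a x * b x) \<in> borel_measurable (prod_time M T)"
    using assms by (intro borel_measurable_times procs_measurable)
  have "\<bar>u * v\<bar> \<le> u\<^sup>2 + v\<^sup>2" for u v :: real
  proof -
    have "2 * \<bar>u * v\<bar> \<le> u\<^sup>2 + v\<^sup>2"
      using sum_squares_bound[of "\<bar>u\<bar>" "\<bar>v\<bar>"] by (simp add: abs_mult mult.assoc)
    then show ?thesis by linarith
  qed
  then show "AE x in prod_time M T. norm (a x * b x) \<le> norm ((a x)\<^sup>2 + (b x)\<^sup>2)"
    by (auto simp: abs_mult)
qed

lemma proc_norm_sq:
  assumes "a \<in> procs M F T"
  shows "(proc_norm M T a)\<^sup>2 = (\<integral>x. (a x)\<^sup>2 \<partial>prod_time M T)"
  using assms procs_measurable[OF assms] unfolding proc_norm_def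
  by (simp add: energy_eq_nn_integral integral_eq_nn_integral)

lemma proc_inner_eq_integral:
  assumes "a \<in> procs M F T" "b \<in> procs M F T"
  shows "proc_inner M T a b = (\<integral>x. a x * b x \<partial>prod_time M T)"
  unfolding proc_inner_def using prod.integral_fst'[OF integrable_procs_mult[OF assms]] by simp

lemma proc_inner_self:
  "a \<in> procs M F T \<Longrightarrow> proc_inner M T a a = (proc_norm M T a)\<^sup>2"
  by (simp add: proc_inner_eq_integral proc_norm_sq flip: power2_eq_square)

text \<open>The square is expanded under the integral. Scaling, addition and completing the square
  are all instances for particular \<open>p\<close> and \<open>q\<close>.\<close>

lemma procs_lincomb:
  assumes a: "a \<in> procs M F T" and b: "b \<in> procs M F T"
  shows "(\<lambda>x. p * a x + q * b x) \<in> procs M F T"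
    and "(proc_norm M T (\<lambda>x. p * a x + q * b x))\<^sup>2 =
      p\<^sup>2 * (proc_norm M T a)\<^sup>2 + 2 * p * q * proc_inner M T a b + q\<^sup>2 * (proc_norm M T b)\<^sup>2"
proof -
  have sq: "(p * a x + q * b x)\<^sup>2 = p\<^sup>2 * (a x)\<^sup>2 + 2 * p * q * (a x * b x) + q\<^sup>2 * (b x)\<^sup>2" for x
    by algebra
  have int: "integrable (prod_time M T) (\<lambda>x. (a x)\<^sup>2)" "integrable (prod_time M T) (\<lambda>x. (b x)\<^sup>2)"
    using a b by (simp_all add: procs_iff)
  have "progressively_measurable F T (\<lambda>x. p * a x + q * b x)"
    using a b unfolding procs_def progressively_measurable_def
    by (auto intro!: borel_measurable_add borel_measurable_times)
  then show *: "(\<lambda>x. p * a x + q * b x) \<in> procs M F T"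
    unfolding procs_iff sq using int integrable_procs_mult[OF a b] by auto
  show "(proc_norm M T (\<lambda>x. p * a x + q * b x))\<^sup>2 =
      p\<^sup>2 * (proc_norm M T a)\<^sup>2 + 2 * p * q * proc_inner M T a b + q\<^sup>2 * (proc_norm M T b)\<^sup>2"
    unfolding proc_norm_sq[OF *] proc_norm_sq[OF a] proc_norm_sq[OF b]
      proc_inner_eq_integral[OF a b] sq
    using int integrable_procs_mult[OF a b] by simp
qed

lemma proc_norm_scale:
  assumes "a \<in> procs M F T"
  shows "(proc_norm M T (\<lambda>x. p * a x))\<^sup>2 = p\<^sup>2 * (proc_norm M T a)\<^sup>2"
  using procs_lincomb(2)[OF assms assms, of p 0] by simp

text \<open>As a quadratic in \<open>b\<close>, the difference of
  \<open>c * \<parallel>a + b\<parallel>\<^sup>2\<close> and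
  \<open>\<mu> * \<parallel>b\<parallel>\<^sup>2\<close> has leading coefficient
  \<open>- (\<mu> - c)\<close> and its critical point at \<open>c / (\<mu> - c)\<close> times
  \<open>a\<close>.\<close>

lemma proc_norm_complete_square:
  assumes a: "a \<in> procs M F T" and b: "b \<in> procs M F T" and "\<mu> \<noteq> c"
  shows "c * (proc_norm M T (\<lambda>x. a x + b x))\<^sup>2 =
    (c + c\<^sup>2 / (\<mu> - c)) * (proc_norm M T a)\<^sup>2 + \<mu> * (proc_norm M T b)\<^sup>2
      - (\<mu> - c) * (proc_norm M T (\<lambda>x. b x - c / (\<mu> - c) * a x))\<^sup>2"
proof -
  define r where "r = c / (\<mu> - c)"
  have r: "(\<mu> - c) * r = c" using assms by (simp add: r_def)
  have "(proc_norm M T (\<lambda>x. b x - r * a x))\<^sup>2 =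
      (proc_norm M T b)\<^sup>2 - 2 * r * proc_inner M T a b + r\<^sup>2 * (proc_norm M T a)\<^sup>2"
    using procs_lincomb(2)[OF a b, of "- r" 1] by (simp add: algebra_simps)
  moreover have "(proc_norm M T (\<lambda>x. a x + b x))\<^sup>2 =
      (proc_norm M T a)\<^sup>2 + 2 * proc_inner M T a b + (proc_norm M T b)\<^sup>2"
    using procs_lincomb(2)[OF a b, of 1 1] by simp
  moreover have "c\<^sup>2 / (\<mu> - c) = r * c" by (simp add: r_def power2_eq_square)
  \<comment> \<open>Grouping the factors \<open>(\<mu> - c) * r\<close> lets each of them collapse
    to \<open>c\<close>.\<close>
  moreover have "(\<mu> - c) * (B - 2 * r * I + r\<^sup>2 * A) = (\<mu> - c) * B - 2 * c * I + c * r * A" for A B I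
  proof -
    have "(\<mu> - c) * (B - 2 * r * I + r\<^sup>2 * A)
        = (\<mu> - c) * B - 2 * ((\<mu> - c) * r) * I + ((\<mu> - c) * r) * r * A"
      by (simp only: algebra_simps power2_eq_square)
    then show ?thesis unfolding r .
  qed
  ultimately show ?thesis
    unfolding r_def[symmetric] by (simp add: distrib_left distrib_right left_diff_distrib)
qed

lemma proc_norm_eq_0_iff:
  assumes "a \<in> procs M F T"
  shows "proc_norm M T a = 0 \<longleftrightarrow> (AE x in prod_time M T. a x = 0)"
proof -
  have "proc_norm M T a = 0 \<longleftrightarrow> (\<integral>x. (a x)\<^sup>2 \<partial>prod_time M T) = 0"
    unfolding proc_norm_sq[OF assms, symmetric] by simp
  also have "\<dots> \<longleftrightarrow> (AE x in prod_time M T. (a x)\<^sup>2 = 0)"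
    using assms by (intro integral_nonneg_eq_0_iff_AE) (auto simp: procs_iff)
  finally show ?thesis by simp
qed

lemma procs_sum:
  assumes "\<And>j. j \<in> J \<Longrightarrow> a j \<in> procs M F T" "finite J"
  shows "(\<lambda>x. \<Sum>j\<in>J. p j * a j x) \<in> procs M F T"
  using assms(2,1)
proof (induction J)
  case empty
  show ?case by (simp add: procs_iff progressively_measurable_def)
next
  case (insert j J)
  then show ?case using procs_lincomb(1)[of "a j" "\<lambda>x. \<Sum>j\<in>J. p j * a j x" "p j" 1] by simp
qed

lemma procsN_mult:
  assumes "a \<in> procsN M F T"
  shows "(\<lambda>x. A *v a x) \<in> procsN M F T"
  using assms procs_sum[of UNIV "component a"]
  by (auto simp: procsN_def component_def matrix_vector_mult_def)

lemma procsN_add: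
  assumes "a \<in> procsN M F T" "b \<in> procsN M F T"
  shows "(\<lambda>x. a x + b x) \<in> procsN M F T"
  using assms procs_lincomb(1)[of "component a _" "component b _" 1 1]
  by (auto simp: procsN_def component_def)

lemma procN_norm_sq:
  "(procN_norm M T a)\<^sup>2 = (\<Sum>i\<in>UNIV. (proc_norm M T (component a i))\<^sup>2)"
  by (simp add: procN_norm_def sum_nonneg)

lemma procN_norm_sq_eq_integral:
  assumes "a \<in> procsN M F T"
  shows "(procN_norm M T a)\<^sup>2 = (\<integral>x. (norm (a x))\<^sup>2 \<partial>prod_time M T)"
proof -
  have a: "component a i \<in> procs M F T" for i using assms by (simp add: procsN_def)
  then have "(procN_norm M T a)\<^sup>2 = (\<Sum>i\<in>UNIV. \<integral>x. (component a i x)\<^sup>2 \<partial>prod_time M T)"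
    by (simp add: procN_norm_sq proc_norm_sq)
  also have "\<dots> = (\<integral>x. (\<Sum>i\<in>UNIV. (component a i x)\<^sup>2) \<partial>prod_time M T)"
    using a by (subst Bochner_Integration.integral_sum) (auto simp: procs_iff)
  also have "\<dots> = (\<integral>x. (norm (a x))\<^sup>2 \<partial>prod_time M T)"
    by (simp add: component_def norm_vec_def L2_set_def sum_nonneg)
  finally show ?thesis .
qed

text \<open>Passing to principal coordinates is an isometry at every point, hence also after
  integration.\<close>

lemma procN_norm_principal:
  assumes a: "a \<in> procsN M F T" and Q: "orthogonal_matrix Q"
  shows "(procN_norm M T a)\<^sup>2 = (\<Sum>k\<in>UNIV. (proc_norm M T (component (principal Q a) k))\<^sup>2)"
proof -
  have "principal Q a \<in> procsN M F T" unfolding principal_def by (rule procsN_mult[OF a])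
  then show ?thesis
    using a unfolding procN_norm_sq[of "principal Q a", symmetric]
    by (simp add: procN_norm_sq_eq_integral principal_def norm_transpose_orthogonal_matrix[OF Q])
qed

text \<open>The product measure has total mass \<open>T > 0\<close>, so a process cannot be both
  zero and nonzero almost everywhere.\<close>

lemma AE_nonzero_imp_proc_norm_pos:
  assumes "a \<in> procs M F T" "AE x in prod_time M T. a x \<noteq> 0"
  shows "proc_norm M T a > 0"
proof -
  have "emeasure (prod_time M T) (space M \<times> {0..T}) = emeasure M (space M) * emeasure (time_measure T) {0..T}"
    by (rule time.emeasure_pair_measure_Times) (auto simp: sets_restrict_space)
  also have "\<dots> = ennreal T"
    using horizon_pos emeasure_space_1 by (simp add: emeasure_restrict_space)
  finally have pos: "emeasure (prod_time M T) (space (prod_time M T)) \<noteq> 0"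
    using horizon_pos by (simp add: space_pair_measure space_restrict_space)
  have "\<not> (AE x in prod_time M T. a x = 0)"
  proof
    assume "AE x in prod_time M T. a x = 0"
    with assms(2) have "AE x in prod_time M T. False" by eventually_elim simp
    then show False using pos by (simp add: AE_iff_null null_sets_def)
  qed
  then have "proc_norm M T a \<noteq> 0" using proc_norm_eq_0_iff[OF assms(1)] by simp
  moreover have "proc_norm M T a \<ge> 0" by (simp add: proc_norm_def)
  ultimately show ?thesis by simp
qed

section \<open>The intervention objective\<close>

text \<open>The inner product in the utility becomes the squared norm of the action, of which the
  quadratic cost leaves one half. Averaging over the players turns this half into the shift
  \<open>1 / (2 * real CARD('n))\<close> of the weight.\<close>

lemma intervention_objective_eq:
  fixes G :: "real ^ 'n ^ 'n"
  assumes inv: "invertible (mat 1 - (\<beta> / real CARD('n)) *\<^sub>R G)"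
    and P: "\<forall>\<xi>. \<xi> \<in> procsN M F T \<longrightarrow>
        1 / real CARD('n) *
          (\<Sum>i\<in>UNIV. P (component (aggregate G (nash \<beta> G \<xi>)) i) (component \<xi> i))
        = w\<^sub>0 * (procN_norm M T (nash \<beta> G \<xi>))\<^sup>2"
    and \<theta>: "\<theta> \<in> procsN M F T" and \<eta>: "\<eta> \<in> procsN M F T"
  shows "intervention_objective M T \<beta> P G \<theta> \<eta>
    = (w\<^sub>0 + 1 / (2 * real CARD('n))) * (procN_norm M T (nash \<beta> G (\<lambda>x. \<theta> x + \<eta> x)))\<^sup>2"
proof -
  define \<xi> where "\<xi> = (\<lambda>x. \<theta> x + \<eta> x)"
  define a where "a = nash \<beta> G \<xi>"
  have \<xi>: "\<xi> \<in> procsN M F T" unfolding \<xi>_def by (rule procsN_add[OF \<theta> \<eta>])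
  then have "a \<in> procsN M F T" unfolding a_def nash_def by (rule procsN_mult)
  then have a: "component a i \<in> procs M F T" for i by (simp add: procsN_def)
  \<comment> \<open>The linear system defining the equilibrium, solved for
    \<open>a x\<close>.\<close>
  have "\<xi> x + \<beta> *\<^sub>R aggregate G a x = a x" for x
    using matrix_inv_cancel[OF inv, of "\<xi> x"]
    by (simp add: a_def nash_def aggregate_def matrix_vector_mult_diff_rdistrib
        scaleR_matrix_vector_assoc[symmetric] algebra_simps)
  then have *: "(\<lambda>x. component \<xi> i x + \<beta> * component (aggregate G a) i x) = component a i" for i
    by (simp add: component_def fun_eq_iff vec_eq_iff)
  have "utility M T \<beta> P (component a i) (component (aggregate G a) i) (component \<xi> i)
      = 1 / 2 * (proc_norm M T (component a i))\<^sup>2 + P (component (aggregate G a) i) (component \<xi> i)" for i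
    unfolding utility_def * proc_inner_self[OF a] by simp
  moreover have "(\<lambda>x. component \<theta> i x + component \<eta> i x) = component \<xi> i" for i
    by (simp add: component_def \<xi>_def)
  ultimately have "intervention_objective M T \<beta> P G \<theta> \<eta> = 1 / real CARD('n) *
      (\<Sum>i\<in>UNIV. 1 / 2 * (proc_norm M T (component a i))\<^sup>2 + P (component (aggregate G a) i) (component \<xi> i))"
    unfolding intervention_objective_def Let_def \<xi>_def[symmetric] a_def[symmetric] by simp
  also have "\<dots> = 1 / real CARD('n) * (1 / 2 * (procN_norm M T a)\<^sup>2) + w\<^sub>0 * (procN_norm M T a)\<^sup>2"
    using P[rule_format, OF \<xi>, folded a_def]
    by (simp add: sum.distrib procN_norm_sq distrib_left flip: sum_distrib_left sum_divide_distrib)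
  finally show ?thesis by (simp add: a_def \<xi>_def algebra_simps)
qed

text \<open>In principal coordinates the equilibrium system reads \<open>\<gamma> k\<close> times
  action equals \<open>\<xi>\<close>-coordinate, with \<open>\<gamma> k\<close> nonzero by
  invertibility; the isometry then adds up the squares.\<close>

lemma procN_norm_nash:
  fixes G Q :: "real ^ 'n::{finite,linorder} ^ 'n::{finite,linorder}"
  assumes G: "spectral_decomposition G Q l"
    and inv: "invertible (mat 1 - (\<beta> / real CARD('n)) *\<^sub>R G)"
    and \<xi>: "\<xi> \<in> procsN M F T"
  shows "(procN_norm M T (nash \<beta> G \<xi>))\<^sup>2 = (\<Sum>k\<in>UNIV.
    (1 - \<beta> * l k / real CARD('n)) powi (- 2) * (proc_norm M T (component (principal Q \<xi>) k))\<^sup>2)"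
proof -
  define \<gamma> where "\<gamma> k = 1 - \<beta> * l k / real CARD('n)" for k
  have \<gamma>: "\<gamma> k \<noteq> 0" for k
    using spectral_decomposition_invertible[OF G inv, of k] by (simp add: \<gamma>_def)
  define a where "a = nash \<beta> G \<xi>"
  have a: "a \<in> procsN M F T" unfolding a_def nash_def by (rule procsN_mult[OF \<xi>])
  have Q: "orthogonal_matrix Q" using G by (simp add: spectral_decomposition_def)
  have p: "component (principal Q \<xi>) k \<in> procs M F T" for k
    using procsN_mult[OF \<xi>, of "transpose Q"] by (simp add: procsN_def principal_def)
  have "component (principal Q a) k = (\<lambda>x. inverse (\<gamma> k) * component (principal Q \<xi>) k x)" for k
    using spectral_decomposition_coordinate[OF G, where k = k and c = "\<beta> / real CARD('n)"]
      matrix_inv_cancel[OF inv] \<gamma>[of k]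
    by (metis (no_types, lifting) a_def nash_def component_def principal_def \<gamma>_def
        times_divide_eq_left left_inverse mult.assoc mult_1)
  then have "(proc_norm M T (component (principal Q a) k))\<^sup>2
      = (inverse (\<gamma> k))\<^sup>2 * (proc_norm M T (component (principal Q \<xi>) k))\<^sup>2" for k
    using proc_norm_scale[OF p] by simp
  then show ?thesis
    unfolding a_def[symmetric] procN_norm_principal[OF a Q]
    by (simp add: \<gamma>_def power_int_minus power_inverse)
qed

text \<open>The square is completed in each principal coordinate, and the terms in
  \<open>\<mu>\<close> recombine to the budget norm by orthogonality. Feasibility of
  \<open>\<eta>\<close> does not enter, so any competitor can be inserted.\<close>

lemma intervention_objective_lagrangian:
  fixes G Q :: "real ^ 'n::{finite,linorder} ^ 'n::{finite,linorder}"
  assumes G: "spectral_decomposition G Q l"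
    and inv: "invertible (mat 1 - (\<beta> / real CARD('n)) *\<^sub>R G)"
    and P: "\<forall>\<xi>. \<xi> \<in> procsN M F T \<longrightarrow>
        1 / real CARD('n) *
          (\<Sum>i\<in>UNIV. P (component (aggregate G (nash \<beta> G \<xi>)) i) (component \<xi> i))
        = w\<^sub>0 * (procN_norm M T (nash \<beta> G \<xi>))\<^sup>2"
    and c: "\<forall>k. c k = (w\<^sub>0 + 1 / (2 * real CARD('n))) * (1 - \<beta> * l k / real CARD('n)) powi (- 2)"
    and \<mu>: "\<forall>k. \<mu> > c k"
    and \<theta>: "\<theta> \<in> procsN M F T" and \<eta>: "\<eta> \<in> procsN M F T"
  shows "intervention_objective M T \<beta> P G \<theta> \<eta> =
    (\<Sum>k\<in>UNIV. (c k + (c k)\<^sup>2 / (\<mu> - c k)) * (proc_norm M T (component (principal Q \<theta>) k))\<^sup>2)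
    + \<mu> * (procN_norm M T \<eta>)\<^sup>2
    - (\<Sum>k\<in>UNIV. (\<mu> - c k) * (proc_norm M T (\<lambda>x. component (principal Q \<eta>) k x
        - c k / (\<mu> - c k) * component (principal Q \<theta>) k x))\<^sup>2)"
proof -
  have Q: "orthogonal_matrix Q" using G by (simp add: spectral_decomposition_def)
  have p: "component (principal Q \<theta>) k \<in> procs M F T" "component (principal Q \<eta>) k \<in> procs M F T" for k
    using procsN_mult[OF \<theta>, of "transpose Q"] procsN_mult[OF \<eta>, of "transpose Q"]
    by (simp_all add: procsN_def principal_def)
  have "component (principal Q (\<lambda>x. \<theta> x + \<eta> x)) k
      = (\<lambda>x. component (principal Q \<theta>) k x + component (principal Q \<eta>) k x)" for k
    by (simp add: component_def principal_def matrix_vector_right_distrib)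
  then have "intervention_objective M T \<beta> P G \<theta> \<eta> = (\<Sum>k\<in>UNIV. c k *
      (proc_norm M T (\<lambda>x. component (principal Q \<theta>) k x + component (principal Q \<eta>) k x))\<^sup>2)"
    unfolding intervention_objective_eq[OF inv P \<theta> \<eta>] procN_norm_nash[OF G inv procsN_add[OF \<theta> \<eta>]]
    using c by (simp add: sum_distrib_left mult.assoc)
  also have "\<dots> = (\<Sum>k\<in>UNIV.
      (c k + (c k)\<^sup>2 / (\<mu> - c k)) * (proc_norm M T (component (principal Q \<theta>) k))\<^sup>2
      + \<mu> * (proc_norm M T (component (principal Q \<eta>) k))\<^sup>2
      - (\<mu> - c k) * (proc_norm M T (\<lambda>x. component (principal Q \<eta>) k x
        - c k / (\<mu> - c k) * component (principal Q \<theta>) k x))\<^sup>2)"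
    using \<mu> by (intro sum.cong refl proc_norm_complete_square p) (metis less_irrefl)
  finally show ?thesis
    unfolding procN_norm_principal[OF \<eta> Q]
    by (simp add: sum.distrib sum_subtractf sum_distrib_left)
qed

end

theorem theorem4p5:
  fixes M :: "'w measure" and F :: "real \<Rightarrow> 'w measure" and T :: real
    and G Q :: "real ^ 'n::{finite,linorder} ^ 'n::{finite,linorder}"
    and l :: "'n::{finite,linorder} \<Rightarrow> real"
    and \<beta> C w\<^sub>0 w :: real and \<alpha> :: "'n::{finite,linorder} \<Rightarrow> real"
    and P :: "('w \<times> real \<Rightarrow> real) \<Rightarrow> ('w \<times> real \<Rightarrow> real) \<Rightarrow> real"
    and \<theta> :: "'w \<times> real \<Rightarrow> real ^ 'n::{finite,linorder}"
  assumes "usual_filtered_prob_space M F T"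
    and G_range: "\<forall>i j. 0 \<le> G $ i $ j \<and> G $ i $ j \<le> 1"
    and G_sym: "transpose G = G"
    and G_diag: "\<forall>i. G $ i $ i = 0"
    and spectral: "spectral_decomposition G Q l"
    and C_pos: "C > 0"
    and theta: "\<theta> \<in> procsN M F T"
    and inverse_exists: "invertible (mat 1 - (\<beta> / real CARD('n)) *\<^sub>R G)"
    and B1: "\<beta> * largest_eigenvalue G < real CARD('n)"
    and B2_P: "\<forall>\<xi>. \<xi> \<in> procsN M F T \<longrightarrow>
        1 / real CARD('n) *
          (\<Sum>i\<in>UNIV. P (component (aggregate G (nash \<beta> G \<xi>)) i) (component \<xi> i))
        = w\<^sub>0 * (procN_norm M T (nash \<beta> G \<xi>))\<^sup>2"
    and B2_sign: "w\<^sub>0 < - 1 / (2 * real CARD('n)) \<and>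
          1 / real CARD('n) * (procN_norm M T \<theta>)\<^sup>2 > C
        \<or> w\<^sub>0 > - 1 / (2 * real CARD('n))"
    and B2_nonzero: "\<forall>k. AE x in prod_time M T. principal Q \<theta> x $ k \<noteq> 0"
    and w: "w = w\<^sub>0 + 1 / (2 * real CARD('n))"
    and alpha: "\<forall>k. \<alpha> k = (1 - \<beta> * l k / real CARD('n)) powi (- 2)"
  shows "(\<exists>!\<mu>. budget_multiplier M T C Q \<theta> w \<alpha> \<mu>)
    \<and> (\<exists>\<theta>'. optimal_intervention M F T C \<beta> P G \<theta> \<theta>')
    \<and> (\<forall>\<mu> \<theta>'. budget_multiplier M T C Q \<theta> w \<alpha> \<mu>
          \<longrightarrow> optimal_intervention M F T C \<beta> P G \<theta> \<theta>'
          \<longrightarrow> (\<forall>k. AE x in prod_time M T.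
                cosine_similarity (\<theta>' x) (column k Q)
                = norm (\<theta> x) / norm (\<theta>' x) * cosine_similarity (\<theta> x) (column k Q)
                  * (w * \<alpha> k / (\<mu> - w * \<alpha> k)))
            \<and> (\<forall>k. AE x in prod_time M T.
                principal Q \<theta>' x $ k
                = w * \<alpha> k / (\<mu> - w * \<alpha> k) * principal Q \<theta> x $ k))"
proof -

  \<comment> \<open>Coefficients and energies in principal coordinates\<close>
  interpret usual_filtered_prob_space M F T by fact
  define c where "c k = w * \<alpha> k" for k
  define s where "s k = (proc_norm M T (component (principal Q \<theta>) k))\<^sup>2" for k
  define f where "f \<mu> = (\<Sum>k\<in>UNIV. (c k / (\<mu> - c k))\<^sup>2 * s k)" for \<mu>
  define N where "N = real CARD('n)"
  have N: "N > 0" by (simp add: N_def)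
  have Q: "orthogonal_matrix Q" using spectral by (simp add: spectral_decomposition_def)
  have in_procs: "component (principal Q \<eta>) k \<in> procs M F T" if "\<eta> \<in> procsN M F T"
    for \<eta> :: "'w \<times> real \<Rightarrow> real ^ 'n::{finite,linorder}" and k
    using procsN_mult[OF that, of "transpose Q"] by (simp add: procsN_def principal_def)
  have s: "\<forall>k. s k > 0"
    using AE_nonzero_imp_proc_norm_pos[OF in_procs[OF theta]] B2_nonzero
    unfolding s_def component_def by (simp add: less_imp_neq[THEN not_sym])
  have \<alpha>: "\<alpha> k > 0" for k
    using spectral_decomposition_invertible[OF spectral inverse_exists, of k]
    by (simp add: alpha power_int_minus)
  have theta_norm: "(procN_norm M T \<theta>)\<^sup>2 = sum s UNIV"
    unfolding s_def by (rule procN_norm_principal[OF theta Q])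
  \<comment> \<open>The sign alternative in terms of the shifted weight; in either case
    \<open>w\<close> is nonzero, hence so is every \<open>c k\<close>.\<close>
  have sign: "w < 0 \<and> sum s UNIV > N * C \<or> w > 0"
    using B2_sign N unfolding theta_norm w N_def by (auto simp: field_simps)
  have c: "\<forall>k. c k \<noteq> 0" using sign \<alpha> by (auto simp: c_def less_imp_neq[THEN not_sym])
  have budget: "budget_multiplier M T C Q \<theta> w \<alpha> \<mu> \<longleftrightarrow> (\<forall>k. \<mu> > c k) \<and> f \<mu> = N * C" for \<mu>
    using N unfolding budget_multiplier_def f_def c_def s_def N_def by (auto simp: field_simps)
  note decreasing = inverse_square_sum_strict_decreasing[OF _ c s, folded f_def]

  \<comment> \<open>Existence, uniqueness and positivity of the multiplier\<close>
  have neg: "(\<forall>k. 0 > c k) \<and> f 0 > N * C" if "w < 0"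
  proof -
    have "c k < 0" for k using that \<alpha> by (simp add: c_def mult_neg_pos)
    moreover have "f 0 = sum s UNIV" using c by (simp add: f_def power_divide)
    ultimately show ?thesis using sign that by simp
  qed
  \<comment> \<open>A left end for the intermediate value argument: a point close to the largest
    pole if \<open>w > 0\<close>, and 0 if \<open>w < 0\<close>, where every ratio
    \<open>c k / (0 - c k)\<close> is -1 and \<open>f 0\<close> is the whole energy of
    \<open>\<theta>\<close>.\<close>
  have "\<exists>\<mu>. (\<forall>k. \<mu> > c k) \<and> f \<mu> > N * C"
  proof (cases "w > 0")
    case True
    then have "\<forall>k. c k > 0" using \<alpha> by (simp add: c_def)
    then show ?thesis using inverse_square_sum_unbounded[of c s] s unfolding f_def by blast
  next
    case False
    then show ?thesis using neg sign by blast
  qed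
  then have ex: "\<exists>\<mu>. budget_multiplier M T C Q \<theta> w \<alpha> \<mu>"
    unfolding budget using inverse_square_sum_root[of c _ "N * C" s, folded f_def] N C_pos by auto
  have unique: "\<mu> = \<mu>'" if "budget_multiplier M T C Q \<theta> w \<alpha> \<mu>" "budget_multiplier M T C Q \<theta> w \<alpha> \<mu>'" for \<mu> \<mu>'
    using that decreasing[of \<mu> \<mu>'] decreasing[of \<mu>' \<mu>] unfolding budget
    by (metis less_irrefl linorder_neqE_linordered_idom)
  \<comment> \<open>For \<open>w > 0\<close> the multiplier exceeds a positive pole. For
    \<open>w < 0\<close>, \<open>f 0\<close> is above the value \<open>N * C\<close> taken at
    \<open>\<mu>\<close>, and monotonicity puts \<open>\<mu>\<close> to the right of 0.\<close>
  have pos: "\<mu> > 0" if "budget_multiplier M T C Q \<theta> w \<alpha> \<mu>" for \<mu>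
  proof (cases "w > 0")
    case True
    then have "c k > 0" for k using \<alpha> by (simp add: c_def)
    then show ?thesis using that unfolding budget by (meson less_trans)
  next
    case False
    then have "f 0 > f \<mu>" using neg sign that budget by auto
    then show ?thesis using decreasing[of \<mu> 0] that unfolding budget
      by (metis less_asym linorder_neqE_linordered_idom)
  qed

  \<comment> \<open>Lagrangian form of the objective\<close>
  define D where "D \<mu> \<eta> = (\<Sum>k\<in>UNIV. (\<mu> - c k) * (proc_norm M T (\<lambda>x. component (principal Q \<eta>) k x
        - c k / (\<mu> - c k) * component (principal Q \<theta>) k x))\<^sup>2)" for \<mu> \<eta>
  define K where "K \<mu> = (\<Sum>k\<in>UNIV. (c k + (c k)\<^sup>2 / (\<mu> - c k)) * s k)" for \<mu>
  let ?J = "intervention_objective M T \<beta> P G \<theta>"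
  let ?feasible = "feasible_intervention M F T C"
  have lagrangian: "?J \<eta> = K \<mu> + \<mu> * (procN_norm M T \<eta>)\<^sup>2 - D \<mu> \<eta>"
    if "budget_multiplier M T C Q \<theta> w \<alpha> \<mu>" "\<eta> \<in> procsN M F T" for \<mu> \<eta>
    unfolding K_def D_def s_def
    using that alpha w unfolding budget
    by (intro intervention_objective_lagrangian[OF spectral inverse_exists B2_P _ _ theta])
       (auto simp: c_def)
  have D_nonneg: "D \<mu> \<eta> \<ge> 0" if "budget_multiplier M T C Q \<theta> w \<alpha> \<mu>" for \<mu> \<eta>
    unfolding D_def using that unfolding budget by (intro sum_nonneg mult_nonneg_nonneg) (auto simp: less_imp_le)

  \<comment> \<open>The candidate and its optimality\<close>
  \<comment> \<open>The required scaling of each principal coordinate, conjugated back by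
    \<open>Q\<close>. As a constant matrix applied to \<open>\<theta>\<close> it stays in
    \<open>procsN\<close>.\<close>
  define opt where "opt \<mu> = (\<lambda>x. (Q ** (\<chi> i j. if i = j then c i / (\<mu> - c i) else 0) ** transpose Q) *v \<theta> x)" for \<mu>
  have opt_procs: "opt \<mu> \<in> procsN M F T" for \<mu>
    unfolding opt_def by (rule procsN_mult[OF theta])
  have opt_principal: "component (principal Q (opt \<mu>)) k
      = (\<lambda>x. c k / (\<mu> - c k) * component (principal Q \<theta>) k x)" for \<mu> k
  proof -
    have "((\<chi> i j. if i = j then r i else 0) *v v) $ k = r k * v $ k" for r and v :: "real ^ 'n::{finite,linorder}"
      by (simp add: matrix_vector_mult_def if_distrib[where f = "\<lambda>x. x * _"] sum.delta cong: if_cong)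
    then show ?thesis
      by (simp add: component_def principal_def opt_def orthogonal_matrix_cancel[OF Q] flip: matrix_vector_mul_assoc)
  qed
  \<comment> \<open>Every difference in \<open>D\<close> is the zero process, which lies in
    \<open>procs\<close> as an empty sum.\<close>
  have D_opt: "D \<mu> (opt \<mu>) = 0" for \<mu>
    using proc_norm_eq_0_iff[of "\<lambda>x. 0"] procs_sum[of "{}"]
    by (simp add: D_def opt_principal)
  \<comment> \<open>The squared norm of the candidate is \<open>f \<mu>\<close>, so the budget
    equation says that the budget is exhausted.\<close>
  have opt_norm: "(procN_norm M T (opt \<mu>))\<^sup>2 = N * C" if "budget_multiplier M T C Q \<theta> w \<alpha> \<mu>" for \<mu>
    using that
    unfolding procN_norm_principal[OF opt_procs Q] opt_principal proc_norm_scale[OF in_procs[OF theta]]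
      budget f_def s_def
    by blast
  have feasible_iff: "?feasible \<eta> \<longleftrightarrow> \<eta> \<in> procsN M F T \<and> (procN_norm M T \<eta>)\<^sup>2 \<le> N * C"
    for \<eta> :: "'w \<times> real \<Rightarrow> real ^ 'n::{finite,linorder}"
    using N by (auto simp: feasible_intervention_def N_def field_simps)
  have opt_feasible: "?feasible (opt \<mu>)" if "budget_multiplier M T C Q \<theta> w \<alpha> \<mu>" for \<mu>
    using opt_procs opt_norm[OF that] by (simp add: feasible_iff)
  \<comment> \<open>On subtracting the two Lagrangian forms \<open>K \<mu>\<close> cancels; what
    remains is \<open>\<mu>\<close> times the unspent budget of \<open>\<eta>\<close>, nonnegative
    since \<open>\<mu> > 0\<close>.\<close>
  have gap: "?J \<eta> + D \<mu> \<eta> \<le> ?J (opt \<mu>)"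
    if "budget_multiplier M T C Q \<theta> w \<alpha> \<mu>" "?feasible \<eta>" for \<mu> \<eta>
    using that lagrangian[OF that(1), of \<eta>] lagrangian[OF that(1) opt_procs, of \<mu>]
      opt_norm[OF that(1)] D_opt[of \<mu>] pos[OF that(1)]
    by (simp add: feasible_iff mult_left_mono)
  have optimal: "optimal_intervention M F T C \<beta> P G \<theta> (opt \<mu>)"
    if "budget_multiplier M T C Q \<theta> w \<alpha> \<mu>" for \<mu>
    using opt_feasible[OF that] gap[OF that] D_nonneg[OF that]
    unfolding optimal_intervention_def is_arg_max_linorder by (smt (verit))

  \<comment> \<open>Form of every optimal intervention and the cosine formula\<close>
  have principal_eq: "AE x in prod_time M T.
      principal Q \<theta>' x $ k = w * \<alpha> k / (\<mu> - w * \<alpha> k) * principal Q \<theta> x $ k"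
    if \<mu>: "budget_multiplier M T C Q \<theta> w \<alpha> \<mu>" and \<theta>': "optimal_intervention M F T C \<beta> P G \<theta> \<theta>'" for \<mu> \<theta>' k
  proof -
    have feas: "?feasible \<theta>'" and "?J (opt \<mu>) \<le> ?J \<theta>'"
      using \<theta>' opt_feasible[OF \<mu>] by (auto simp: optimal_intervention_def is_arg_max_linorder)
    \<comment> \<open>An optimum is at least as good as the candidate, so the gap forces
      \<open>D\<close> to vanish. Its weights are positive, hence every summand has norm
      zero.\<close>
    then have "D \<mu> \<theta>' = 0" using gap[OF \<mu> feas] D_nonneg[OF \<mu>, of \<theta>'] by linarith
    then have "(\<mu> - c k) * (proc_norm M T (\<lambda>x. component (principal Q \<theta>') k x
        - c k / (\<mu> - c k) * component (principal Q \<theta>) k x))\<^sup>2 = 0"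
      using \<mu> unfolding D_def budget
      by (subst (asm) sum_nonneg_eq_0_iff) (auto simp: less_imp_le)
    moreover have "\<mu> - c k \<noteq> 0" using \<mu> unfolding budget by (metis less_irrefl right_minus_eq)
    moreover have "(\<lambda>x. component (principal Q \<theta>') k x
        - c k / (\<mu> - c k) * component (principal Q \<theta>) k x) \<in> procs M F T"
      using procs_lincomb(1)[OF in_procs[of \<theta>' k] in_procs[OF theta, of k], of 1 "- (c k / (\<mu> - c k))"] feas
      by (simp add: feasible_iff)
    ultimately show ?thesis
      using proc_norm_eq_0_iff by (fastforce simp: component_def c_def)
  qed
  have cosine: "AE x in prod_time M T. cosine_similarity (\<theta>' x) (column k Q)
      = norm (\<theta> x) / norm (\<theta>' x) * cosine_similarity (\<theta> x) (column k Q) * (w * \<alpha> k / (\<mu> - w * \<alpha> k))"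
    if \<mu>: "budget_multiplier M T C Q \<theta> w \<alpha> \<mu>" and \<theta>': "optimal_intervention M F T C \<beta> P G \<theta> \<theta>'" for \<mu> \<theta>' k
    using principal_eq[OF \<mu> \<theta>', of k] B2_nonzero[rule_format, of k]
  proof eventually_elim
    case (elim x)
    \<comment> \<open>A nonzero principal coordinate makes the vector nonzero, so
      \<open>norm (\<theta> x)\<close> cancels against the denominator of its cosine
      similarity.\<close>
    then have "\<theta> x \<noteq> 0" by (auto simp: principal_def)
    then show ?case
      using elim(1) by (simp add: cosine_similarity_def inner_column principal_def mult_ac)
  qed
  show ?thesis using ex unique optimal principal_eq cosine by blast
qed

end
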